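(* Let $\xi_\theta$ and $\xi_\kappa$, $\theta,\kappa\in J$, be elements of the Cameron–Martin basis. Then, with probability 1, $$\xi_\theta\,\xi_\kappa=\sum_{n=0}^\infty\frac{\mathcal D^n\xi_\theta\,\lozenge\,\mathcal D^n\xi_\kappa}{n!}.$$
   Context: $Y$ is a real separable Hilbert space, $T>0$, $\mathbf H=L_2([0,T],Y)$, $W$ is a cylindrical Wiener process in $Y$ on $[0,T]$. $\mathbf b=\{e_k\}_{k\ge1}$ is a complete orthonormal basis (CONS) of $\mathbf H$ of the form $e_k(s)=m_{k_1}(s)\ell_{k_2}$, where $\{m_i\}$ is a CONS of $L_2([0,T])$ with $\sup_s|m_i(s)|<\infty$ for each $i$ and $\{\ell_i\}$ is a CONS of $Y$. $J$ is the set of multiindices $\alpha=(\alpha_k)_{k\ge1}$ of nonnegative integers with $|\alpha|=\sum_k\alpha_k<\infty$; $\alpha!=\prod_k\alpha_k!$; $\varepsilon_k$ is the unit multiindex at $k$. $\xi_\alpha=\prod_kH_{\alpha_k}(W(e_k))/\sqrt{\alpha!}$ with $W(e_k)=\int_0^Te_k(t)\,dW_t$ and $H_n(x)=(-1)^ne^{x^2/2}\frac{d^n}{dx^n}e^{-x^2/2}$ (the Cameron–Martin basis of $L_2(\Omega,\mathcal F^W,\mathbf P)$). Malliavin derivative: $\mathcal D\xi_\mu=\sum_{k\ge1}\sqrt{\mu_k}\,\xi_{\mu-\varepsilon_k}e_k$, an $\mathbf H$-valued finite chaos sum; iterating, $\mathcal D^n\xi_\mu=\sum_\alpha\Big(\sum_{|p|=n}1_{p+\alpha=\mu}\sqrt{\frac{(\alpha+p)!}{\alpha!}}\,u_p\Big)\xi_\alpha$,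 where $u_p=\sum_{(k_1,\dots,k_n):\,\varepsilon_{k_1}+\dots+\varepsilon_{k_n}=p}e_{k_1}\otimes\cdots\otimes e_{k_n}\in\mathbf H^{\otimes n}$ ($\mathcal D^0\xi_\mu=\xi_\mu$, $\mathbf H^{\otimes0}=\mathbf R$). Wick product: for a Hilbert space $E$ and $v=\sum_\alpha v_\alpha\xi_\alpha$, $u=\sum_\alpha u_\alpha\xi_\alpha$ with coefficients in $E$, $v\lozenge u=\sum_\alpha\sum_{\beta\le\alpha}(u_\beta,v_{\alpha-\beta})_E\sqrt{\frac{\alpha!}{\beta!(\alpha-\beta)!}}\,\xi_\alpha$ (real valued); in the claim $E=\mathbf H^{\otimes n}$. *)

theory Defs
  imports "HOL-Probability.Probability" "HOL-Library.Multiset"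
begin

section \<open>Square-integrable functions and complete orthonormal systems\<close>

text \<open>Elements of L2([0,T],E) are represented by functions on the real line; values outside
  [0,T] and on null sets are irrelevant.\<close>

abbreviation leb :: "real \<Rightarrow> real measure" where
  "leb T \<equiv> restrict_space lborel {0..T}"

definition L2 :: "real \<Rightarrow> (real \<Rightarrow> 'b::real_inner) set" where
  "L2 T = {f. f \<in> borel_measurable (leb T) \<and> integrable (leb T) (\<lambda>s. (norm (f s))\<^sup>2)}"

definition l2_inner :: "real \<Rightarrow> (real \<Rightarrow> 'b::real_inner) \<Rightarrow> (real \<Rightarrow> 'b) \<Rightarrow> real" where
  "l2_inner T f g = (\<integral>s. f s \<bullet> g s \<partial>leb T)"

definition cons_L2 :: "real \<Rightarrow> (nat \<Rightarrow> real \<Rightarrow> 'b::real_inner) \<Rightarrow> bool" where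
  "cons_L2 T f \<longleftrightarrow>
     (\<forall>i. f i \<in> L2 T) \<and>
     (\<forall>i j. l2_inner T (f i) (f j) = (if i = j then 1 else 0)) \<and>
     (\<forall>g\<in>L2 T. (\<forall>i. l2_inner T g (f i) = 0) \<longrightarrow> (AE s in leb T. g s = 0))"

text \<open>The index set is a parameter because the space may be finite-dimensional.\<close>

definition cons_on :: "nat set \<Rightarrow> (nat \<Rightarrow> 'b::real_inner) \<Rightarrow> bool" where
  "cons_on I l \<longleftrightarrow>
     (\<forall>i\<in>I. \<forall>j\<in>I. l i \<bullet> l j = (if i = j then 1 else 0)) \<and>
     (\<forall>y. (\<forall>i\<in>I. y \<bullet> l i = 0) \<longrightarrow> y = 0)"

section \<open>Cylindrical Wiener processes and the Wiener integral\<close>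

definition centered_gaussian :: "'a measure \<Rightarrow> ('a \<Rightarrow> real) \<Rightarrow> real \<Rightarrow> bool" where
  "centered_gaussian M X v \<longleftrightarrow>
     X \<in> borel_measurable M \<and>
     (if v = 0 then (AE \<omega> in M. X \<omega> = 0)
      else v > 0 \<and> distributed M lborel X (\<lambda>x. ennreal (normal_density 0 (sqrt v) x)))"

text \<open>\<open>W t y\<close> is the value at time \<open>t\<close> in direction \<open>y\<close>. The second condition says that
  the family is jointly Gaussian and centered, with covariance
  E[W(t,y) W(s,z)] = min(t,s) (y,z).\<close>

definition cylindrical_wiener ::
    "'a measure \<Rightarrow> real \<Rightarrow> (real \<Rightarrow> 'y::real_inner \<Rightarrow> 'a \<Rightarrow> real) \<Rightarrow> bool" where
  "cylindrical_wiener M T W \<longleftrightarrow>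
     (\<forall>t\<in>{0..T}. \<forall>y. W t y \<in> borel_measurable M) \<and>
     (\<forall>(n::nat) (c :: nat \<Rightarrow> real) t y. (\<forall>i<n. t i \<in> {0..T}) \<longrightarrow>
        centered_gaussian M (\<lambda>\<omega>. \<Sum>i<n. c i * W (t i) (y i) \<omega>)
          (\<Sum>i<n. \<Sum>j<n. c i * c j * min (t i) (t j) * (y i \<bullet> y j))) \<and>
     (\<forall>y. AE \<omega> in M. continuous_on {0..T} (\<lambda>t. W t y \<omega>))"

text \<open>A list of triples \<open>(r, t, y)\<close> stands for the sum of the step functions \<open>1(r,t] y\<close>, whose integral is
  \<open>\<Sum> (W t y - W r y)\<close>. The Wiener integral is the isometric extension to L2. Like
  \<open>has_integral\<close>, the notion is a relation: \<open>X\<close> is any version of the integral of \<open>f\<close>.\<close>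

definition step_fun :: "(real \<times> real \<times> 'y::real_vector) list \<Rightarrow> real \<Rightarrow> 'y" where
  "step_fun S x = (\<Sum>(r, t, y)\<leftarrow>S. indicator {r<..t} x *\<^sub>R y)"

definition step_integral ::
    "(real \<Rightarrow> 'y \<Rightarrow> 'a \<Rightarrow> real) \<Rightarrow> (real \<times> real \<times> 'y) list \<Rightarrow> 'a \<Rightarrow> real" where
  "step_integral W S \<omega> = (\<Sum>(r, t, y)\<leftarrow>S. W t y \<omega> - W r y \<omega>)"

definition has_wiener_integral ::
    "'a measure \<Rightarrow> real \<Rightarrow> (real \<Rightarrow> 'y::real_inner \<Rightarrow> 'a \<Rightarrow> real) \<Rightarrow> (real \<Rightarrow> 'y) \<Rightarrow> ('a \<Rightarrow> real) \<Rightarrow> bool"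
  where
  "has_wiener_integral M T W f X \<longleftrightarrow>
     f \<in> L2 T \<and> X \<in> borel_measurable M \<and>
     (\<exists>S. (\<forall>n::nat. \<forall>(r, t, y)\<in>set (S n). 0 \<le> r \<and> r \<le> t \<and> t \<le> T) \<and>
          (\<lambda>n. \<integral>\<^sup>+s. ennreal ((norm (step_fun (S n) s - f s))\<^sup>2) \<partial>leb T) \<longlonglongrightarrow> 0 \<and>
          (\<lambda>n. \<integral>\<^sup>+\<omega>. ennreal ((step_integral W (S n) \<omega> - X \<omega>)\<^sup>2) \<partial>M) \<longlonglongrightarrow> 0)"

section \<open>The Cameron--Martin basis\<close>

text \<open>A multiindex (a finitely supported family of natural numbers) is a multiset of indices:
  \<open>count \<alpha> k\<close> is the entry at \<open>k\<close>, \<open>size \<alpha>\<close> is |\<open>\<alpha>\<close>|, \<open>{#k#}\<close> is the unit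
  multiindex at \<open>k\<close> and \<open>\<subseteq>#\<close> is the entrywise order. Indices start at 0.\<close>

type_synonym multiindex = "nat multiset"

definition mfact :: "multiindex \<Rightarrow> real" where
  "mfact \<alpha> = (\<Prod>k\<in>set_mset \<alpha>. fact (count \<alpha> k))"

definition hermite :: "nat \<Rightarrow> real \<Rightarrow> real" where
  "hermite n x = (-1) ^ n * exp (x\<^sup>2 / 2) * (deriv ^^ n) (\<lambda>z. exp (- z\<^sup>2 / 2)) x"

text \<open>\<open>Z k\<close> plays the role of W(e(k)). Since \<open>hermite 0 = (\<lambda>_. 1)\<close>, the product may be
  restricted to the support of \<open>\<alpha>\<close>.\<close>

definition xi :: "(nat \<Rightarrow> 'a \<Rightarrow> real) \<Rightarrow> multiindex \<Rightarrow> 'a \<Rightarrow> real" where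
  "xi Z \<alpha> \<omega> = (\<Prod>k\<in>set_mset \<alpha>. hermite (count \<alpha> k) (Z k \<omega>)) / sqrt (mfact \<alpha>)"

section \<open>Tensor powers\<close>

text \<open>The n-th Hilbert tensor power of H = L2([0,T],Y) is modelled by Hilbert--Schmidt n-linear
  functionals on H, the elementary tensor of \<open>h1, \<dots>, hn\<close> being
  \<open>(g1, \<dots>, gn) \<mapsto> (h1, g1) \<cdots> (hn, gn)\<close>. Arguments are passed as lists of length n, and
  functionals vanish on lists of other lengths. The zeroth power is identified with the reals by
  \<open>F \<mapsto> F []\<close>. The inner product of two functionals is the sum of the products of their values on
  n-tuples from a complete orthonormal system \<open>e\<close> of H; it does not depend on the choice of \<open>e\<close>.\<close>

type_synonym 'y tensor = "(real \<Rightarrow> 'y) list \<Rightarrow> real"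

definition elem_tensor :: "real \<Rightarrow> (real \<Rightarrow> 'y::real_inner) list \<Rightarrow> 'y tensor" where
  "elem_tensor T hs gs =
     (if length gs = length hs then \<Prod>i<length hs. l2_inner T (hs ! i) (gs ! i) else 0)"

text \<open>The product \<open>F \<otimes> h\<close> of a tensor with one further vector.\<close>

definition tensor_snoc :: "real \<Rightarrow> 'y tensor \<Rightarrow> (real \<Rightarrow> 'y::real_inner) \<Rightarrow> 'y tensor" where
  "tensor_snoc T F h gs = (if gs = [] then 0 else F (butlast gs) * l2_inner T h (last gs))"

definition tensor_inner ::
    "(nat \<Rightarrow> real \<Rightarrow> 'y) \<Rightarrow> nat \<Rightarrow> 'y tensor \<Rightarrow> 'y tensor \<Rightarrow> real" where
  "tensor_inner e n F G = (\<Sum>\<^sub>\<infinity>ks\<in>{ks. length ks = n}. F (map e ks) * G (map e ks))"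

lemma elem_tensor_basis:
  assumes "cons_L2 T e" "length ks = length js"
  shows "elem_tensor T (map e ks) (map e js) = (if ks = js then 1 else 0)"
proof (cases "ks = js")
  case True
  with assms show ?thesis by (simp add: elem_tensor_def cons_L2_def)
next
  case False
  with assms(2) obtain i where "i < length ks" "ks ! i \<noteq> js ! i"
    using nth_equalityI by blast
  then have "\<exists>i\<in>{..<length ks}. l2_inner T (map e ks ! i) (map e js ! i) = 0"
    using assms by (intro bexI[of _ i]) (simp_all add: cons_L2_def)
  with False assms(2) show ?thesis
    by (simp add: elem_tensor_def)
qed

lemma tensor_inner_basis:
  assumes "cons_L2 T e" "length ks = n" "length js = n"
  shows "tensor_inner e n (elem_tensor T (map e ks)) (elem_tensor T (map e js)) = (if ks = js then 1 else 0)"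
proof -
  have "tensor_inner e n (elem_tensor T (map e ks)) (elem_tensor T (map e js))
      = (\<Sum>\<^sub>\<infinity>is\<in>{ks}. if ks = js then 1 else 0)"
    unfolding tensor_inner_def
    by (rule infsum_cong_neutral) (use assms in \<open>auto simp: elem_tensor_basis\<close>)
  then show ?thesis by simp
qed

section \<open>Chaos sums, Malliavin derivative and Wick product\<close>

text \<open>A chaos sum \<open>\<Sum> v(\<alpha>) \<xi>(\<alpha>)\<close> is given by its family of coefficients \<open>v\<close>. All families that
  occur are finitely supported (for infinite support the sum below would be 0).\<close>

definition chaos_sum :: "(nat \<Rightarrow> 'a \<Rightarrow> real) \<Rightarrow> (multiindex \<Rightarrow> real) \<Rightarrow> 'a \<Rightarrow> real" where
  "chaos_sum Z v \<omega> = (\<Sum>\<alpha> | v \<alpha> \<noteq> 0. v \<alpha> * xi Z \<alpha> \<omega>)"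

text \<open>The linear extension to tensor-valued finite chaos sums of
  \<open>D \<xi>(\<mu>) = \<Sum>k. sqrt (\<mu>(k)) \<xi>(\<mu> - \<epsilon>(k)) e(k)\<close>, that is,
  \<open>D (\<Sum> v(\<mu>) \<xi>(\<mu>)) = \<Sum> v(\<mu>) \<otimes> D \<xi>(\<mu>)\<close>; the value below is its coefficient at \<open>\<alpha>\<close>.\<close>

definition malliavin ::
    "real \<Rightarrow> (nat \<Rightarrow> real \<Rightarrow> 'y::real_inner) \<Rightarrow> (multiindex \<Rightarrow> 'y tensor) \<Rightarrow> multiindex \<Rightarrow> 'y tensor"
  where
  "malliavin T e v \<alpha> gs =
     (\<Sum>\<mu> | v \<mu> \<noteq> (\<lambda>_. 0). \<Sum>k\<in>set_mset \<mu>.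
        if \<mu> - {#k#} = \<alpha> then sqrt (real (count \<mu> k)) * tensor_snoc T (v \<mu>) (e k) gs else 0)"

definition malliavin_xi ::
    "real \<Rightarrow> (nat \<Rightarrow> real \<Rightarrow> 'y::real_inner) \<Rightarrow> nat \<Rightarrow> multiindex \<Rightarrow> multiindex \<Rightarrow> 'y tensor" where
  "malliavin_xi T e n \<mu> =
     (malliavin T e ^^ n) (\<lambda>\<alpha>. if \<alpha> = \<mu> then elem_tensor T [] else (\<lambda>_. 0))"

text \<open>The Wick product of two chaos sums with coefficients in an inner product space, where \<open>ip\<close>
  is the inner product.\<close>

definition wick ::
    "('b \<Rightarrow> 'b \<Rightarrow> real) \<Rightarrow> (multiindex \<Rightarrow> 'b) \<Rightarrow> (multiindex \<Rightarrow> 'b) \<Rightarrow> multiindex \<Rightarrow> real" where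
  "wick ip v u \<alpha> =
     (\<Sum>\<beta> | \<beta> \<subseteq># \<alpha>. ip (u \<beta>) (v (\<alpha> - \<beta>)) * sqrt (mfact \<alpha> / (mfact \<beta> * mfact (\<alpha> - \<beta>))))"

section \<open>Closed form of the iterated derivative\<close>

definition sym_tensor :: "real \<Rightarrow> (nat \<Rightarrow> real \<Rightarrow> 'y::real_inner) \<Rightarrow> multiindex \<Rightarrow> 'y tensor" where
  "sym_tensor T e p gs =
     (\<Sum>ks | length ks = size p \<and> (\<Sum>k\<leftarrow>ks. {#k#}) = p. elem_tensor T (map e ks) gs)"

lemma sum_list_single_mset: "(\<Sum>k\<leftarrow>ks. {#k#}) = mset ks"
  by (induction ks) auto

lemma sym_tensor_mset: "sym_tensor T e p gs = (\<Sum>ks | mset ks = p. elem_tensor T (map e ks) gs)"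
  unfolding sym_tensor_def sum_list_single_mset
  by (rule sum.cong) auto

lemma finite_mset_eq: "finite {ks. mset ks = p}"
proof -
  have "{ks. mset ks = p} \<subseteq> {ks. set ks \<subseteq> set_mset p \<and> length ks = size p}"
    by auto
  then show ?thesis
    by (rule finite_subset) (simp add: finite_lists_length_eq)
qed

lemma finite_submset: "finite {\<beta>. \<beta> \<subseteq># (\<alpha> :: multiindex)}"
proof -
  have "{\<beta>. \<beta> \<subseteq># \<alpha>} \<subseteq> mset ` {ks. set ks \<subseteq> set_mset \<alpha> \<and> length ks \<le> size \<alpha>}"
  proof
    fix \<beta> assume "\<beta> \<in> {\<beta>. \<beta> \<subseteq># \<alpha>}"
    then have b: "\<beta> \<subseteq># \<alpha>" by simp
    obtain ks where "mset ks = \<beta>" using ex_mset by blast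
    with b show "\<beta> \<in> mset ` {ks. set ks \<subseteq> set_mset \<alpha> \<and> length ks \<le> size \<alpha>}"
      by (metis (mono_tags, lifting) imageI mem_Collect_eq set_mset_mono set_mset_mset
          size_mset size_mset_mono)
  qed
  then show ?thesis
    by (rule finite_subset) (simp add: finite_lists_length_le)
qed

lemma mfact_pos: "mfact \<alpha> > 0"
  unfolding mfact_def by (rule prod_pos) simp

lemma mfact_superset:
  assumes "finite A" "set_mset \<alpha> \<subseteq> A"
  shows "mfact \<alpha> = (\<Prod>k\<in>A. fact (count \<alpha> k))"
  unfolding mfact_def
  by (rule prod.mono_neutral_left) (use assms in \<open>auto simp: not_in_iff\<close>)

lemma mfact_add_single: "mfact (\<alpha> + {#k#}) = real (count \<alpha> k + 1) * mfact \<alpha>"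
proof -
  let ?A = "insert k (set_mset \<alpha>)"
  have "mfact (\<alpha> + {#k#}) = (\<Prod>i\<in>?A. fact (count (\<alpha> + {#k#}) i))"
    by (rule mfact_superset) auto
  also have "\<dots> = fact (Suc (count \<alpha> k)) * (\<Prod>i\<in>?A - {k}. fact (count (\<alpha> + {#k#}) i))"
    by (subst prod.remove[of _ k]) auto
  also have "(\<Prod>i\<in>?A - {k}. fact (count (\<alpha> + {#k#}) i)) = (\<Prod>i\<in>?A - {k}. fact (count \<alpha> i) :: real)"
    by (rule prod.cong) auto
  also have "fact (Suc (count \<alpha> k)) * \<dots> = real (count \<alpha> k + 1) * (\<Prod>i\<in>?A. fact (count \<alpha> i))"
    by (subst (2) prod.remove[of _ k]) (auto simp: algebra_simps)
  also have "(\<Prod>i\<in>?A. fact (count \<alpha> i)) = mfact \<alpha>"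
    by (rule mfact_superset[symmetric]) auto
  finally show ?thesis .
qed

lemma tensor_snoc_elem: "tensor_snoc T (elem_tensor T hs) h gs = elem_tensor T (hs @ [h]) gs"
proof (cases gs rule: rev_cases)
  case Nil
  then show ?thesis by (simp add: tensor_snoc_def elem_tensor_def)
next
  case (snoc fs f)
  then show ?thesis
    by (auto simp: tensor_snoc_def elem_tensor_def nth_append intro!: prod.cong)
qed

lemma sym_tensor_snoc:
  assumes "p \<noteq> {#}"
  shows "sym_tensor T e p gs = (\<Sum>k\<in>set_mset p. tensor_snoc T (sym_tensor T e (p - {#k#})) (e k) gs)"
proof -
  have snoc: "tensor_snoc T (sym_tensor T e q) (e k) gs
      = (\<Sum>ks | mset ks = q. elem_tensor T (map e (ks @ [k])) gs)" for q k
  proof -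
    have "tensor_snoc T (sym_tensor T e q) (e k) gs
        = (\<Sum>ks | mset ks = q. tensor_snoc T (elem_tensor T (map e ks)) (e k) gs)"
      by (simp add: tensor_snoc_def sym_tensor_mset sum_distrib_right)
    then show ?thesis by (simp add: tensor_snoc_elem)
  qed
  have "(\<Sum>k\<in>set_mset p. tensor_snoc T (sym_tensor T e (p - {#k#})) (e k) gs)
      = (\<Sum>(k, ks)\<in>(SIGMA k:set_mset p. {ks. mset ks = p - {#k#}}). elem_tensor T (map e (ks @ [k])) gs)"
    unfolding snoc by (rule sum.Sigma) (auto simp: finite_mset_eq)
  also have "\<dots> = (\<Sum>ks | mset ks = p. elem_tensor T (map e ks) gs)"
  proof (rule sum.reindex_bij_witness[where i = "\<lambda>ks. (last ks, butlast ks)" and j = "\<lambda>(k, ks). ks @ [k]"])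
    fix ks assume "ks \<in> {ks. mset ks = p}"
    with assms have ks: "mset ks = p" "ks \<noteq> []" by auto
    then obtain js k where "ks = js @ [k]" by (metis rev_exhaust)
    with ks show "(last ks, butlast ks) \<in> (SIGMA k:set_mset p. {ks. mset ks = p - {#k#}})"
      by auto
    show "(case (last ks, butlast ks) of (k, ks) \<Rightarrow> ks @ [k]) = ks"
      using ks by simp
  qed auto
  finally show ?thesis by (simp add: sym_tensor_mset)
qed

lemma malliavin_xi_closed:
  "malliavin_xi T e n \<mu> \<alpha> gs =
     (if \<alpha> \<subseteq># \<mu> \<and> size \<mu> = size \<alpha> + n
      then sqrt (mfact \<mu> / mfact \<alpha>) * sym_tensor T e (\<mu> - \<alpha>) gs else 0)"
proof (induction n arbitrary: \<alpha> gs)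
  case 0
  have "\<alpha> \<subseteq># \<mu> \<and> size \<mu> = size \<alpha> \<longleftrightarrow> \<alpha> = \<mu>"
    by (metis mset_subset_size nat_neq_iff subset_mset.order_refl subset_mset.le_neq_trans)
  moreover have "sym_tensor T e {#} gs = elem_tensor T [] gs"
    by (simp add: sym_tensor_mset)
  moreover have "mfact \<mu> / mfact \<mu> = 1"
    using mfact_pos[of \<mu>] by simp
  ultimately show ?case
    by (simp add: malliavin_xi_def)
next
  case (Suc n)
  let ?v = "malliavin_xi T e n \<mu>"
  have step: "malliavin_xi T e (Suc n) \<mu> = malliavin T e ?v"
    by (simp add: malliavin_xi_def)
  have supp: "?v \<nu> = (\<lambda>_. 0)" if "\<not> \<nu> \<subseteq># \<mu>" for \<nu>
    using that by (auto simp: Suc.IH)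
  have "malliavin T e ?v \<alpha> gs = (\<Sum>\<nu> | \<nu> \<subseteq># \<mu>. \<Sum>k\<in>set_mset \<nu>.
      if \<nu> - {#k#} = \<alpha> then sqrt (real (count \<nu> k)) * tensor_snoc T (?v \<nu>) (e k) gs else 0)"
    unfolding malliavin_def
  proof (rule sum.mono_neutral_left)
    show "{\<nu>. ?v \<nu> \<noteq> (\<lambda>_. 0)} \<subseteq> {\<nu>. \<nu> \<subseteq># \<mu>}"
      using supp by blast
    show "\<forall>\<nu>\<in>{\<nu>. \<nu> \<subseteq># \<mu>} - {\<nu>. ?v \<nu> \<noteq> (\<lambda>_. 0)}. (\<Sum>k\<in>set_mset \<nu>.
        if \<nu> - {#k#} = \<alpha> then sqrt (real (count \<nu> k)) * tensor_snoc T (?v \<nu>) (e k) gs else 0) = 0"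
      by (intro ballI sum.neutral) (simp add: tensor_snoc_def)
  qed (rule finite_submset)
  also have "\<dots> = (\<Sum>(\<nu>, k)\<in>(SIGMA \<nu>:{\<nu>. \<nu> \<subseteq># \<mu>}. set_mset \<nu>).
      if \<nu> - {#k#} = \<alpha> then sqrt (real (count \<nu> k)) * tensor_snoc T (?v \<nu>) (e k) gs else 0)"
    by (rule sum.Sigma) (auto simp: finite_submset)
  also have "\<dots> = (\<Sum>(\<nu>, k)\<in>{(\<nu>, k). \<nu> \<subseteq># \<mu> \<and> k \<in># \<nu> \<and> \<nu> - {#k#} = \<alpha>}.
      sqrt (real (count \<nu> k)) * tensor_snoc T (?v \<nu>) (e k) gs)"
    by (rule sum.mono_neutral_cong_right) (auto simp: finite_submset split: if_splits)
  also have "\<dots> = (\<Sum>k | \<alpha> + {#k#} \<subseteq># \<mu>.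
      sqrt (real (count \<alpha> k + 1)) * tensor_snoc T (?v (\<alpha> + {#k#})) (e k) gs)"
    by (rule sum.reindex_bij_witness[where i = "\<lambda>k. (\<alpha> + {#k#}, k)" and j = snd]) auto
  finally have red: "malliavin_xi T e (Suc n) \<mu> \<alpha> gs = (\<Sum>k | \<alpha> + {#k#} \<subseteq># \<mu>.
      sqrt (real (count \<alpha> k + 1)) * tensor_snoc T (?v (\<alpha> + {#k#})) (e k) gs)"
    unfolding step .
  show ?case
  proof (cases "\<alpha> \<subseteq># \<mu> \<and> size \<mu> = size \<alpha> + Suc n")
    case False
    have "\<not> (\<alpha> + {#k#} \<subseteq># \<mu> \<and> size \<mu> = size (\<alpha> + {#k#}) + n)" for k
      using False by (auto dest: mset_subset_eq_insertD subset_mset.less_imp_le)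
    then have "?v (\<alpha> + {#k#}) = (\<lambda>_. 0)" for k
      unfolding fun_eq_iff Suc.IH by meson
    then have "malliavin_xi T e (Suc n) \<mu> \<alpha> gs = 0"
      unfolding red by (intro sum.neutral) (simp add: tensor_snoc_def)
    with False show ?thesis by auto
  next
    case True
    then have sub: "\<alpha> \<subseteq># \<mu>" and size: "size \<mu> = size \<alpha> + Suc n" by auto
    have ne: "\<mu> - \<alpha> \<noteq> {#}"
    proof
      assume "\<mu> - \<alpha> = {#}"
      then have "size (\<mu> - \<alpha>) = 0" by simp
      with size show False by (simp add: size_Diff_submset[OF sub])
    qed
    have ind: "{k. \<alpha> + {#k#} \<subseteq># \<mu>} = set_mset (\<mu> - \<alpha>)"
    proof -
      have "\<alpha> + {#k#} \<subseteq># \<mu> \<longleftrightarrow> k \<in># \<mu> - \<alpha>" for k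
        using subset_mset.le_diff_conv2[OF sub, of \<open>{#k#}\<close>] by (simp add: add.commute)
      then show ?thesis by auto
    qed
    have "sqrt (real (count \<alpha> k + 1)) * tensor_snoc T (?v (\<alpha> + {#k#})) (e k) gs
        = sqrt (mfact \<mu> / mfact \<alpha>) * tensor_snoc T (sym_tensor T e (\<mu> - \<alpha> - {#k#})) (e k) gs"
      if "k \<in># \<mu> - \<alpha>" for k
    proof -
      have k: "\<alpha> + {#k#} \<subseteq># \<mu>" using that ind by blast
      have v: "?v (\<alpha> + {#k#}) = (\<lambda>fs. sqrt (mfact \<mu> / mfact (\<alpha> + {#k#})) *
          sym_tensor T e (\<mu> - \<alpha> - {#k#}) fs)"
        using k size by (auto simp: Suc.IH fun_eq_iff)
      have "sqrt (real (count \<alpha> k + 1)) * sqrt (mfact \<mu> / mfact (\<alpha> + {#k#})) = sqrt (mfact \<mu> / mfact \<alpha>)"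
        unfolding mfact_add_single real_sqrt_mult[symmetric]
        by (rule arg_cong[where f = sqrt]) (simp del: of_nat_add of_nat_Suc)
      then show ?thesis
        unfolding v by (simp add: tensor_snoc_def flip: mult.assoc)
    qed
    then have "malliavin_xi T e (Suc n) \<mu> \<alpha> gs = sqrt (mfact \<mu> / mfact \<alpha>) * sym_tensor T e (\<mu> - \<alpha>) gs"
      unfolding red ind sym_tensor_snoc[OF ne] sum_distrib_left by (intro sum.cong) auto
    with True show ?thesis by simp
  qed
qed

lemma malliavin_xi_formula:
  "malliavin_xi T e n \<mu> \<alpha> gs =
     (\<Sum>p | size p = n \<and> p + \<alpha> = \<mu>. sqrt (mfact (\<alpha> + p) / mfact \<alpha>) * sym_tensor T e p gs)"
proof (cases "\<alpha> \<subseteq># \<mu> \<and> size \<mu> = size \<alpha> + n")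
  case True
  then have "{p. size p = n \<and> p + \<alpha> = \<mu>} = {\<mu> - \<alpha>}"
    by (auto simp: size_Diff_submset)
  with True show ?thesis
    by (simp add: malliavin_xi_closed)
next
  case False
  then have "{p. size p = n \<and> p + \<alpha> = \<mu>} = {}"
    by auto
  with False show ?thesis
    by (simp only: malliavin_xi_closed) simp
qed

end

theory Submission
  imports Defs "HOL-Combinatorics.Multiset_Permutations"
begin

text \<open>The identity holds for every \<open>\<omega>\<close>, not only almost surely, because both sides are the same
  polynomial in the numbers \<open>Z k \<omega>\<close>. It rests on the linearization formula for Hermite
  polynomials,

    \<open>H\<^sub>m H\<^sub>n = \<Sum>\<^sub>j m! n! / (j! (m - j)! (n - j)!) H\<^sub>m\<^sub>+\<^sub>n\<^sub>-\<^sub>2\<^sub>j\<close>.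

  Multiplying it over all coordinates turns the exponent \<open>j\<close> into a multiindex \<open>p\<close> lying below both
  \<open>\<theta>\<close> and \<open>\<kappa>\<close>, and after normalization gives the chaos expansion of \<open>\<xi>(\<theta>) \<xi>(\<kappa>)\<close> (lemma
  \<open>xi_mult\<close>), one term \<open>\<xi>((\<theta> - p) + (\<kappa> - p))\<close> for each such \<open>p\<close>.

  The right-hand side sorts these terms by the order \<open>n = |p|\<close>. The coefficient of \<open>D\<^sup>n \<xi>(\<kappa>)\<close> at
  \<open>\<beta>\<close> is a multiple of the symmetric tensor \<open>u(\<kappa> - \<beta>)\<close>, and symmetric tensors of different
  multiindices are orthogonal. So the inner product with the coefficient of \<open>D\<^sup>n \<xi>(\<theta>)\<close> at \<open>\<gamma>\<close>
  survives only if both derivatives remove the same multiindex \<open>p = \<kappa> - \<beta> = \<theta> - \<gamma>\<close> of size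
  \<open>n\<close>, and then the squared norm of \<open>u(p)\<close> counts the words with content \<open>p\<close>, which are
  \<open>n! / p!\<close> in number. The factor \<open>n!\<close> cancels against the denominator of the series, and the Wick
  weight completes what is left to the coefficient in \<open>xi_mult\<close> (lemma
  \<open>chaos_sum_wick_malliavin_xi\<close>). Since \<open>p\<close> lies below \<open>\<theta>\<close>, the series has only finitely many
  nonzero terms.\<close>

section \<open>Linearization of products of Hermite polynomials\<close>

lemma hermite_0 [simp]: "hermite 0 x = 1"
  by (simp add: hermite_def mult_exp_exp)

text \<open>The three-term recurrence, from which the derivative can be computed by induction. It is
  identified below with the Rodrigues formula defining \<open>hermite\<close>.\<close>

fun hermite_rec :: "nat \<Rightarrow> real \<Rightarrow> real" where
  "hermite_rec 0 x = 1"
| "hermite_rec (Suc 0) x = x"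
| "hermite_rec (Suc (Suc n)) x = x * hermite_rec (Suc n) x - real (Suc n) * hermite_rec n x"

lemma hermite_rec_Suc:
  "hermite_rec (Suc n) x = x * hermite_rec n x - real n * hermite_rec (n - 1) x"
  by (cases n) auto

lemma DERIV_hermite_rec:
  "(hermite_rec n has_field_derivative real n * hermite_rec (n - 1) x) (at x)"
proof (induction n x rule: hermite_rec.induct)
  case (1 x)
  have "hermite_rec 0 = (\<lambda>x. 1)" by auto
  then show ?case by simp
next
  case (2 x)
  have "hermite_rec (Suc 0) = (\<lambda>x. x)" by auto
  then show ?case by simp
next
  case (3 n x)
  have "hermite_rec (Suc (Suc n))
      = (\<lambda>x. x * hermite_rec (Suc n) x - real (Suc n) * hermite_rec n x)" by auto
  moreover have "((\<lambda>x. x * hermite_rec (Suc n) x - real (Suc n) * hermite_rec n x)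
      has_field_derivative
        hermite_rec (Suc n) x + x * (real (Suc n) * hermite_rec n x)
          - real (Suc n) * (real n * hermite_rec (n - 1) x)) (at x)"
    using 3 by (auto intro!: derivative_eq_intros)
  moreover have "hermite_rec (Suc n) x + x * (real (Suc n) * hermite_rec n x)
          - real (Suc n) * (real n * hermite_rec (n - 1) x)
      = real (Suc (Suc n)) * hermite_rec (Suc n) x"
    unfolding hermite_rec_Suc[of n] by (simp add: algebra_simps)
  ultimately show ?case by simp
qed

lemma funpow_deriv_gaussian:
  "(deriv ^^ n) (\<lambda>z. exp (- z\<^sup>2 / 2)) = (\<lambda>z. (-1) ^ n * hermite_rec n z * exp (- z\<^sup>2 / 2))"
proof (induction n)
  case 0
  show ?case by simp
next
  case (Suc n)
  have "((\<lambda>z. (-1) ^ n * hermite_rec n z * exp (- z\<^sup>2 / 2)) has_field_derivative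
      (-1) ^ Suc n * hermite_rec (Suc n) z * exp (- z\<^sup>2 / 2)) (at z)" for z
    unfolding hermite_rec_Suc
    by (rule derivative_eq_intros DERIV_hermite_rec refl | simp)+ (simp add: algebra_simps)
  then show ?case
    unfolding funpow.simps comp_def Suc by (intro ext DERIV_imp_deriv)
qed

lemma hermite_eq_rec: "hermite n x = hermite_rec n x"
proof -
  have "hermite n x = ((-1) ^ n * (-1) ^ n) * (exp (x\<^sup>2 / 2) * exp (- x\<^sup>2 / 2)) * hermite_rec n x"
    unfolding hermite_def funpow_deriv_gaussian by (simp only: mult_ac)
  then show ?thesis
    by (simp add: mult_exp_exp flip: power_mult_distrib)
qed

lemma hermite_Suc: "hermite (Suc n) x = x * hermite n x - real n * hermite (n - 1) x"
  unfolding hermite_eq_rec by (rule hermite_rec_Suc)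

text \<open>Induction on \<open>m\<close> with the recurrence \<open>H\<^sub>m\<^sub>+\<^sub>1 = x H\<^sub>m - m H\<^sub>m\<^sub>-\<^sub>1\<close>. Multiplying a term
  \<open>H\<^sub>k\<close> of the expansion of \<open>H\<^sub>m H\<^sub>n\<close> by \<open>x\<close> raises its degree and, through \<open>k H\<^sub>k\<^sub>-\<^sub>1\<close> with
  \<open>k = (m - j) + (n - j)\<close>, also lowers it. The share \<open>m - j\<close> of the lowered term cancels against
  \<open>m H\<^sub>m\<^sub>-\<^sub>1 H\<^sub>n\<close>; the share \<open>n - j\<close> joins the next raised term by Pascal's rule. Binomial
  coefficients let \<open>j\<close> run up to \<open>m\<close> without regard to \<open>n\<close>.\<close>

lemma hermite_mult:
  "hermite m x * hermite n x =
     (\<Sum>j\<le>m. fact j * real (m choose j) * real (n choose j) * hermite (m + n - 2 * j) x)"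
proof (induction m rule: less_induct)
  case (less m)
  define c where "c m j = fact j * real (m choose j) * real (n choose j)" for m j
  define h where "h i = hermite i x" for i
  have IH: "h i * h n = (\<Sum>j\<le>i. c i j * h (i + n - 2 * j))" if "i < m" for i
    using less that by (simp add: c_def h_def)
  have "h m * h n = (\<Sum>j\<le>m. c m j * h (m + n - 2 * j))"
  proof (cases m)
    case 0
    then show ?thesis by (simp add: c_def h_def)
  next
    case (Suc i)
    have times_x: "x * h k = h (Suc k) + real k * h (k - 1)" for k
      by (simp add: h_def hermite_Suc)
    (* both sides vanish for i = 0, where the degree i - 1 is truncated *)
    have lower: "real i * (h (i - 1) * h n) = (\<Sum>j\<le>i. real (i - j) * c i j * h (i + n - 2 * j - 1))"
    proof (cases i)
      case (Suc i')
      have "real i * (h i' * h n) = (\<Sum>j\<le>i'. real i * c i' j * h (i' + n - 2 * j))"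
        using IH[of i'] \<open>m = Suc i\<close> Suc by (simp add: sum_distrib_left mult_ac)
      also have "\<dots> = (\<Sum>j\<le>i'. real (i - j) * c i j * h (i + n - 2 * j - 1))"
      proof (rule sum.cong)
        fix j assume "j \<in> {..i'}"
        have "real i * real (i' choose j) = real (i - j) * real (i choose j)"
          using binomial_absorb_comp[of i j] Suc by (metis diff_Suc_1 of_nat_mult)
        then show "real i * c i' j * h (i' + n - 2 * j) = real (i - j) * c i j * h (i + n - 2 * j - 1)"
          using Suc by (simp add: c_def)
      qed simp
      finally show ?thesis using Suc by simp
    qed simp
    (* for n < j the coefficients vanish, so the truncated degrees are harmless *)
    have step: "c i j * (x * h (i + n - 2 * j)) - real (i - j) * c i j * h (i + n - 2 * j - 1)
        = c i j * h (m + n - 2 * j)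
          + fact (Suc j) * real (i choose j) * real (n choose Suc j) * h (m + n - 2 * Suc j)"
      if "j \<le> i" for j
    proof (cases "j \<le> n")
      case True
      have "real (n - j) * real (n choose j) = real (Suc j) * real (n choose Suc j)"
        by (metis binomial_absorb_comp binomial_absorption of_nat_mult)
      then have "fact (Suc j) * real (i choose j) * real (n choose Suc j) = real (n - j) * c i j"
        by (simp add: c_def algebra_simps)
      moreover have "real (i + n - 2 * j) = real (i - j) + real (n - j)"
        using that True by simp
      moreover have "Suc (i + n - 2 * j) = m + n - 2 * j" "i + n - 2 * j - 1 = m + n - 2 * Suc j"
        using that True Suc by auto
      ultimately show ?thesis
        unfolding times_x by (simp only:) (simp add: ring_distribs)
    next
      case False
      then show ?thesis by (simp add: c_def binomial_eq_0)
    qed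
    have "h m * h n = x * (h i * h n) - real i * (h (i - 1) * h n)"
      by (simp add: \<open>m = Suc i\<close> h_def hermite_Suc algebra_simps)
    also have "x * (h i * h n) = (\<Sum>j\<le>i. c i j * (x * h (i + n - 2 * j)))"
      unfolding IH[of i, unfolded \<open>m = Suc i\<close>, OF lessI] sum_distrib_left by (simp only: mult_ac)
    also have "\<dots> - real i * (h (i - 1) * h n) = (\<Sum>j\<le>i. c i j * h (m + n - 2 * j)
        + fact (Suc j) * real (i choose j) * real (n choose Suc j) * h (m + n - 2 * Suc j))"
      unfolding lower sum_subtractf[symmetric] by (rule sum.cong[OF refl], rule step) simp
    also have "\<dots> = (\<Sum>j\<le>Suc i. c i j * h (m + n - 2 * j))
        + (\<Sum>j\<le>i. fact (Suc j) * real (i choose j) * real (n choose Suc j) * h (m + n - 2 * Suc j))"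
      by (simp add: sum.distrib c_def)
    also have "\<dots> = (\<Sum>j\<le>Suc i. c m j * h (m + n - 2 * j))"
    proof -
      have pascal: "c m (Suc j) = c i (Suc j) + fact (Suc j) * real (i choose j) * real (n choose Suc j)" for j
        by (simp only: c_def Suc binomial_Suc_Suc of_nat_add ring_distribs add.commute)
      have "c m 0 = c i 0"
        by (simp add: c_def)
      then show ?thesis
        unfolding sum.atMost_Suc_shift pascal by (simp only: ring_distribs sum.distrib add.assoc)
    qed
    finally show ?thesis by (simp only: Suc)
  qed
  then show ?case by (simp add: c_def h_def)
qed

lemma hermite_mult_fact:
  "hermite m x * hermite n x =
     (\<Sum>j\<le>min m n. fact m * fact n / (fact j * fact (m - j) * fact (n - j))
        * hermite ((m - j) + (n - j)) x)"
proof -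
  have "hermite m x * hermite n x =
     (\<Sum>j\<le>min m n. fact j * real (m choose j) * real (n choose j) * hermite (m + n - 2 * j) x)"
    unfolding hermite_mult by (rule sum.mono_neutral_right) auto
  also have "\<dots> = (\<Sum>j\<le>min m n. fact m * fact n / (fact j * fact (m - j) * fact (n - j))
        * hermite ((m - j) + (n - j)) x)"
  proof (rule sum.cong)
    fix j assume "j \<in> {..min m n}"
    then have "j \<le> m" "j \<le> n" by auto
    moreover from this have "m + n - 2 * j = (m - j) + (n - j)" by simp
    ultimately show "fact j * real (m choose j) * real (n choose j) * hermite (m + n - 2 * j) x
        = fact m * fact n / (fact j * fact (m - j) * fact (n - j)) * hermite ((m - j) + (n - j)) x"
      by (simp add: binomial_fact field_simps)
  qed simp
  finally show ?thesis .
qed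

section \<open>Chaos expansion of a product of basis elements\<close>

text \<open>Choosing an exponent up to \<open>count \<mu> k\<close> at each coordinate \<open>k\<close> is the same as choosing a
  submultiset of \<open>\<mu>\<close>; with this, distributivity carries one-dimensional expansions over to
  multiindices.\<close>

lemma prod_sum_submultisets:
  fixes f :: "'b \<Rightarrow> nat \<Rightarrow> real"
  assumes A: "finite A" "set_mset \<mu> \<subseteq> A"
  shows "(\<Prod>k\<in>A. \<Sum>j\<le>count \<mu> k. f k j) = (\<Sum>p | p \<subseteq># \<mu>. \<Prod>k\<in>A. f k (count p k))"
proof -
  have "(\<Prod>k\<in>A. \<Sum>j\<le>count \<mu> k. f k j) = (\<Sum>g\<in>(\<Pi>\<^sub>E k\<in>A. {..count \<mu> k}). \<Prod>k\<in>A. f k (g k))"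
    by (rule prod_sum_PiE) (use A in auto)
  also have "\<dots> = (\<Sum>p | p \<subseteq># \<mu>. \<Prod>k\<in>A. f k (count p k))"
  proof (rule sum.reindex_bij_witness[where i = "\<lambda>p. restrict (count p) A"
        and j = "\<lambda>g. Abs_multiset (\<lambda>k. if k \<in> A then g k else 0)"])
    have cnt: "count (Abs_multiset (\<lambda>k. if k \<in> A then g k else 0)) = (\<lambda>k. if k \<in> A then g k else 0)"
      for g :: "'b \<Rightarrow> nat"
      by (rule Abs_multiset_inverse) (use A in \<open>auto elim: rev_finite_subset\<close>)
    fix g assume g: "g \<in> (\<Pi>\<^sub>E k\<in>A. {..count \<mu> k})"
    show "restrict (count (Abs_multiset (\<lambda>k. if k \<in> A then g k else 0))) A = g"
      unfolding cnt using g by (auto simp: fun_eq_iff PiE_def extensional_def)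
    show "Abs_multiset (\<lambda>k. if k \<in> A then g k else 0) \<in> {p. p \<subseteq># \<mu>}"
      using g by (auto simp: subseteq_mset_def cnt PiE_def Pi_def)
    show "(\<Prod>k\<in>A. f k (count (Abs_multiset (\<lambda>k. if k \<in> A then g k else 0)) k))
        = (\<Prod>k\<in>A. f k (g k))"
      unfolding cnt by (rule prod.cong) auto
  next
    fix p assume "p \<in> {p. p \<subseteq># \<mu>}"
    then have p: "p \<subseteq># \<mu>" by simp
    then have "count p k = 0" if "k \<notin> A" for k
      using that A mset_subset_eqD[OF p, of k] by (auto simp: not_in_iff[symmetric])
    then have "(\<lambda>k. if k \<in> A then restrict (count p) A k else 0) = count p"
      by (auto simp: fun_eq_iff)
    then show "Abs_multiset (\<lambda>k. if k \<in> A then restrict (count p) A k else 0) = p"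
      by (simp add: count_inverse)
    show "restrict (count p) A \<in> (\<Pi>\<^sub>E k\<in>A. {..count \<mu> k})"
      using p by (auto simp: subseteq_mset_def)
  qed
  finally show ?thesis .
qed

text \<open>Enlarging the range of coordinates is possible since \<open>hermite 0\<close> is constant 1. It brings the
  products for several multiindices to a common index set.\<close>

lemma xi_superset:
  assumes "finite A" "set_mset \<alpha> \<subseteq> A"
  shows "(\<Prod>k\<in>A. hermite (count \<alpha> k) (Z k \<omega>)) = sqrt (mfact \<alpha>) * xi Z \<alpha> \<omega>"
proof -
  have "(\<Prod>k\<in>set_mset \<alpha>. hermite (count \<alpha> k) (Z k \<omega>)) = (\<Prod>k\<in>A. hermite (count \<alpha> k) (Z k \<omega>))"
    by (rule prod.mono_neutral_left) (use assms in \<open>auto simp: not_in_iff\<close>)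
  then show ?thesis
    using mfact_pos[of \<alpha>] by (simp add: xi_def)
qed

text \<open>The weight of \<open>\<xi>((\<theta> - p) + (\<kappa> - p))\<close> in \<open>\<xi>(\<theta>) \<xi>(\<kappa>)\<close>. It is meant for \<open>p\<close> below both
  \<open>\<theta>\<close> and \<open>\<kappa>\<close>.\<close>

definition contraction_coeff :: "multiindex \<Rightarrow> multiindex \<Rightarrow> multiindex \<Rightarrow> real" where
  "contraction_coeff \<theta> \<kappa> p =
     sqrt (mfact \<theta> * mfact \<kappa> * mfact ((\<theta> - p) + (\<kappa> - p)))
       / (mfact p * mfact (\<theta> - p) * mfact (\<kappa> - p))"

text \<open>One application of the linearization formula per coordinate in the support of \<open>\<theta>\<close> or
  \<open>\<kappa>\<close>. The factor \<open>sqrt (mfact \<theta>) * sqrt (mfact \<kappa>)\<close> that turns basis elements into plain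
  Hermite products is carried along and cancelled at the end.\<close>

lemma xi_mult:
  "xi Z \<theta> \<omega> * xi Z \<kappa> \<omega> =
     (\<Sum>p | p \<subseteq># \<theta> \<inter># \<kappa>. contraction_coeff \<theta> \<kappa> p * xi Z ((\<theta> - p) + (\<kappa> - p)) \<omega>)"
proof -
  define A where "A = set_mset \<theta> \<union> set_mset \<kappa>"
  have A: "finite A" "set_mset \<theta> \<subseteq> A" "set_mset \<kappa> \<subseteq> A" "set_mset (\<theta> \<inter># \<kappa>) \<subseteq> A"
    by (auto simp: A_def)
  define f where "f k j = fact (count \<theta> k) * fact (count \<kappa> k)
      / (fact j * fact (count \<theta> k - j) * fact (count \<kappa> k - j))
      * hermite ((count \<theta> k - j) + (count \<kappa> k - j)) (Z k \<omega>)" for k j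
  have "sqrt (mfact \<theta>) * xi Z \<theta> \<omega> * (sqrt (mfact \<kappa>) * xi Z \<kappa> \<omega>)
      = (\<Prod>k\<in>A. hermite (count \<theta> k) (Z k \<omega>) * hermite (count \<kappa> k) (Z k \<omega>))"
    by (simp add: xi_superset[OF A(1,2), symmetric] xi_superset[OF A(1,3), symmetric] prod.distrib)
  also have "\<dots> = (\<Prod>k\<in>A. \<Sum>j\<le>count (\<theta> \<inter># \<kappa>) k. f k j)"
    by (simp add: hermite_mult_fact f_def)
  also have "\<dots> = (\<Sum>p | p \<subseteq># \<theta> \<inter># \<kappa>. \<Prod>k\<in>A. f k (count p k))"
    by (rule prod_sum_submultisets) (use A in auto)
  also have "\<dots> = (\<Sum>p | p \<subseteq># \<theta> \<inter># \<kappa>. sqrt (mfact \<theta>) * sqrt (mfact \<kappa>) *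
      (contraction_coeff \<theta> \<kappa> p * xi Z ((\<theta> - p) + (\<kappa> - p)) \<omega>))"
  proof (rule sum.cong)
    fix p assume "p \<in> {p. p \<subseteq># \<theta> \<inter># \<kappa>}"
    then have sub: "set_mset p \<subseteq> A" "set_mset (\<theta> - p) \<subseteq> A" "set_mset (\<kappa> - p) \<subseteq> A"
      "set_mset ((\<theta> - p) + (\<kappa> - p)) \<subseteq> A"
      using A by (auto dest!: set_mset_mono in_diffD)
    have "(\<Prod>k\<in>A. f k (count p k)) = mfact \<theta> * mfact \<kappa> / (mfact p * mfact (\<theta> - p) * mfact (\<kappa> - p))
        * (\<Prod>k\<in>A. hermite (count ((\<theta> - p) + (\<kappa> - p)) k) (Z k \<omega>))"
      by (simp add: f_def prod.distrib prod_dividef mfact_superset[OF A(1)] A sub)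
    also have "\<dots> = mfact \<theta> * mfact \<kappa> / (mfact p * mfact (\<theta> - p) * mfact (\<kappa> - p))
        * (sqrt (mfact ((\<theta> - p) + (\<kappa> - p))) * xi Z ((\<theta> - p) + (\<kappa> - p)) \<omega>)"
      by (simp only: xi_superset[OF A(1) sub(4)])
    also have "mfact \<theta> * mfact \<kappa> = (sqrt (mfact \<theta>) * sqrt (mfact \<kappa>)) * (sqrt (mfact \<theta>) * sqrt (mfact \<kappa>))"
      using mfact_pos[of \<theta>] mfact_pos[of \<kappa>] by (simp add: mult.assoc mult.left_commute)
    finally show "(\<Prod>k\<in>A. f k (count p k)) = sqrt (mfact \<theta>) * sqrt (mfact \<kappa>) *
      (contraction_coeff \<theta> \<kappa> p * xi Z ((\<theta> - p) + (\<kappa> - p)) \<omega>)"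
      by (simp add: contraction_coeff_def real_sqrt_mult)
  qed simp
  finally have "(sqrt (mfact \<theta>) * sqrt (mfact \<kappa>)) * (xi Z \<theta> \<omega> * xi Z \<kappa> \<omega>)
      = (sqrt (mfact \<theta>) * sqrt (mfact \<kappa>)) *
        (\<Sum>p | p \<subseteq># \<theta> \<inter># \<kappa>. contraction_coeff \<theta> \<kappa> p * xi Z ((\<theta> - p) + (\<kappa> - p)) \<omega>)"
    by (simp add: sum_distrib_left mult_ac)
  then show ?thesis
    using mfact_pos[of \<theta>] mfact_pos[of \<kappa>] by simp
qed

section \<open>Wick product of iterated Malliavin derivatives\<close>

text \<open>On a tuple of basis vectors, \<open>u(p)\<close> is the indicator of the words with content \<open>p\<close>, since it is the
  sum of the elementary tensors of these words. Written additively, the condition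
  \<open>mset js + \<alpha> = \<mu>\<close> avoids truncated differences of multiindices.\<close>

lemma malliavin_xi_basis:
  assumes "cons_L2 T e" "length js = n"
  shows "malliavin_xi T e n \<mu> \<alpha> (map e js) =
    (if mset js + \<alpha> = \<mu> then sqrt (mfact \<mu> / mfact \<alpha>) else 0)"
proof -
  have sym: "sym_tensor T e p (map e js) = (if mset js = p then 1 else 0)" if "size p = n" for p
  proof -
    have "sym_tensor T e p (map e js) = (\<Sum>ks | mset ks = p. if ks = js then 1 else 0)"
      unfolding sym_tensor_mset
    proof (rule sum.cong)
      fix ks assume "ks \<in> {ks. mset ks = p}"
      then have "length ks = length js"
        using that assms by auto
      then show "elem_tensor T (map e ks) (map e js) = (if ks = js then 1 else 0)"
        by (rule elem_tensor_basis[OF assms(1)])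
    qed simp
    then show ?thesis
      by (simp add: finite_mset_eq)
  qed
  have "malliavin_xi T e n \<mu> \<alpha> (map e js) = (\<Sum>p | size p = n \<and> p + \<alpha> = \<mu>.
      if p = mset js then sqrt (mfact (\<alpha> + p) / mfact \<alpha>) else 0)"
    unfolding malliavin_xi_formula by (rule sum.cong) (auto simp: sym)
  also have "\<dots> = (if mset js + \<alpha> = \<mu> then sqrt (mfact \<mu> / mfact \<alpha>) else 0)"
  proof -
    have "finite {p. size p = n \<and> p + \<alpha> = \<mu>}"
      by (rule finite_subset[OF _ finite_submset[of \<mu>]]) auto
    then show ?thesis
      using assms(2) by (auto simp: sum.delta add.commute)
  qed
  finally show ?thesis .
qed

lemma card_mset_eq: "real (card {ks. mset ks = p}) = fact (size p) / mfact p"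
proof -
  have "card {ks. mset ks = p} * (\<Prod>k\<in>set_mset p. fact (count p k)) = fact (size p)"
    using card_permutations_of_multiset_aux[of p] by (simp add: permutations_of_multiset_def)
  then have "real (card {ks. mset ks = p} * (\<Prod>k\<in>set_mset p. fact (count p k))) = real (fact (size p))"
    by (rule arg_cong)
  then have "real (card {ks. mset ks = p}) * mfact p = fact (size p)"
    by (simp only: mfact_def of_nat_mult of_nat_prod of_nat_fact)
  then show ?thesis
    using mfact_pos[of p] by (simp add: field_simps)
qed

text \<open>A word contributes to the inner product only if its content \<open>p\<close> completes \<open>\<beta>\<close> to \<open>\<kappa>\<close> and \<open>\<gamma>\<close>
  to \<open>\<theta>\<close>; there are \<open>n! / p!\<close> words with content \<open>p\<close>. At most one \<open>p\<close> qualifies, but a sum over all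
  candidates covers the empty case and is what the later reindexing needs.\<close>

lemma tensor_inner_malliavin_xi:
  assumes "cons_L2 T e"
  shows "tensor_inner e n (malliavin_xi T e n \<kappa> \<beta>) (malliavin_xi T e n \<theta> \<gamma>) =
    (\<Sum>p | size p = n \<and> p + \<beta> = \<kappa> \<and> p + \<gamma> = \<theta>.
       sqrt (mfact \<kappa> / mfact \<beta>) * sqrt (mfact \<theta> / mfact \<gamma>) * (fact n / mfact p))"
    (is "_ = (\<Sum>p\<in>?P. ?c * _)")
proof -
  have fin: "finite ?P"
    by (rule finite_subset[OF _ finite_submset[of \<kappa>]]) auto
  have "tensor_inner e n (malliavin_xi T e n \<kappa> \<beta>) (malliavin_xi T e n \<theta> \<gamma>)
      = (\<Sum>\<^sub>\<infinity>ks\<in>(\<Union>p\<in>?P. {ks. mset ks = p}). ?c)"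
    unfolding tensor_inner_def
    by (rule infsum_cong_neutral) (auto simp: malliavin_xi_basis[OF assms])
  also have "\<dots> = (\<Sum>ks\<in>(\<Union>p\<in>?P. {ks. mset ks = p}). ?c)"
    by (rule infsum_finite) (use fin finite_mset_eq in auto)
  also have "\<dots> = (\<Sum>p\<in>?P. \<Sum>ks | mset ks = p. ?c)"
    by (rule sum.UNION_disjoint) (use fin finite_mset_eq in auto)
  also have "\<dots> = (\<Sum>p\<in>?P. ?c * (fact n / mfact p))"
    by (rule sum.cong) (auto simp: card_mset_eq)
  finally show ?thesis .
qed

text \<open>A pair of a splitting \<open>\<alpha> = \<beta> + \<gamma>\<close> and a common removed part \<open>p\<close> is determined by \<open>p\<close> alone,
  because \<open>\<beta> = \<kappa> - p\<close> and \<open>\<gamma> = \<theta> - p\<close>.\<close>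

lemma wick_malliavin_xi:
  assumes "cons_L2 T e"
  shows "wick (tensor_inner e n) (malliavin_xi T e n \<theta>) (malliavin_xi T e n \<kappa>) \<alpha> =
    (\<Sum>p | p \<subseteq># \<theta> \<inter># \<kappa> \<and> size p = n \<and> (\<theta> - p) + (\<kappa> - p) = \<alpha>. fact n * contraction_coeff \<theta> \<kappa> p)"
proof -
  define P where "P \<beta> = {p. size p = n \<and> p + \<beta> = \<kappa> \<and> p + (\<alpha> - \<beta>) = \<theta>}" for \<beta>
  define t where "t \<beta> p = sqrt (mfact \<kappa> / mfact \<beta>) * sqrt (mfact \<theta> / mfact (\<alpha> - \<beta>)) * (fact n / mfact p)
      * sqrt (mfact \<alpha> / (mfact \<beta> * mfact (\<alpha> - \<beta>)))" for \<beta> p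
  have fin: "finite (P \<beta>)" for \<beta>
    unfolding P_def by (rule finite_subset[OF _ finite_submset[of \<kappa>]]) auto
  have "wick (tensor_inner e n) (malliavin_xi T e n \<theta>) (malliavin_xi T e n \<kappa>) \<alpha>
      = (\<Sum>\<beta> | \<beta> \<subseteq># \<alpha>. \<Sum>p\<in>P \<beta>. t \<beta> p)"
    by (simp add: wick_def tensor_inner_malliavin_xi[OF assms] P_def t_def sum_distrib_right)
  also have "\<dots> = (\<Sum>(\<beta>, p)\<in>(SIGMA \<beta>:{\<beta>. \<beta> \<subseteq># \<alpha>}. P \<beta>). t \<beta> p)"
    by (rule sum.Sigma) (use fin finite_submset in auto)
  also have "\<dots> = (\<Sum>p | p \<subseteq># \<theta> \<inter># \<kappa> \<and> size p = n \<and> (\<theta> - p) + (\<kappa> - p) = \<alpha>.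
      fact n * contraction_coeff \<theta> \<kappa> p)"
  proof (rule sum.reindex_bij_witness[where i = "\<lambda>p. (\<kappa> - p, p)" and j = snd])
    fix x assume x: "x \<in> (SIGMA \<beta>:{\<beta>. \<beta> \<subseteq># \<alpha>}. P \<beta>)"
    obtain \<beta> p where [simp]: "x = (\<beta>, p)" by fastforce
    define \<gamma> where "\<gamma> = \<alpha> - \<beta>"
    from x have k: "p + \<beta> = \<kappa>" "p + \<gamma> = \<theta>" "\<gamma> + \<beta> = \<alpha>" "size p = n"
      by (auto simp: P_def \<gamma>_def)
    then have d: "\<kappa> - p = \<beta>" "\<theta> - p = \<gamma>" by auto
    show "(\<kappa> - snd x, snd x) = x"
      by (simp add: d)
    show "snd x \<in> {p. p \<subseteq># \<theta> \<inter># \<kappa> \<and> size p = n \<and> (\<theta> - p) + (\<kappa> - p) = \<alpha>}"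
      using k d by (auto simp flip: k(1,2))
    show "fact n * contraction_coeff \<theta> \<kappa> (snd x) = (case x of (\<beta>, p) \<Rightarrow> t \<beta> p)"
    proof -
      (* the factors sqrt (mfact \<beta>) and sqrt (mfact \<gamma>) occur once in the derivatives and once in
         the Wick weight; grouped in pairs they become mfact \<beta> and mfact \<gamma> *)
      have rearrange: "x / b * (y / c) * (f / q) * (a / (b * c)) = f * ((y * x * a) / (q * (c * c) * (b * b)))"
        for x y a b c f q :: real
        by (simp only: divide_inverse inverse_mult_distrib mult_ac)
      have "t \<beta> p = fact n * (sqrt (mfact \<theta>) * sqrt (mfact \<kappa>) * sqrt (mfact \<alpha>)
          / (mfact p * (sqrt (mfact \<gamma>) * sqrt (mfact \<gamma>)) * (sqrt (mfact \<beta>) * sqrt (mfact \<beta>))))"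
        unfolding t_def \<gamma>_def[symmetric] real_sqrt_mult real_sqrt_divide by (rule rearrange)
      then show ?thesis
        using mfact_pos[of \<beta>] mfact_pos[of \<gamma>] by (simp add: contraction_coeff_def d k real_sqrt_mult)
    qed
  next
    fix p assume "p \<in> {p. p \<subseteq># \<theta> \<inter># \<kappa> \<and> size p = n \<and> (\<theta> - p) + (\<kappa> - p) = \<alpha>}"
    then have "p + (\<kappa> - p) = \<kappa>" "p + (\<theta> - p) = \<theta>" "size p = n" and \<alpha>: "\<alpha> = (\<theta> - p) + (\<kappa> - p)"
      by auto
    moreover have "\<kappa> - p \<subseteq># \<alpha>" "\<alpha> - (\<kappa> - p) = \<theta> - p"
      by (simp_all only: \<alpha> mset_subset_eq_add_right add_diff_cancel_right')
    ultimately show "(\<kappa> - p, p) \<in> (SIGMA \<beta>:{\<beta>. \<beta> \<subseteq># \<alpha>}. P \<beta>)"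
      by (simp add: P_def)
  qed (rule snd_conv)
  finally show ?thesis .
qed

text \<open>Summing over \<open>\<alpha>\<close> removes the constraint \<open>(\<theta> - p) + (\<kappa> - p) = \<alpha>\<close> on \<open>p\<close>, so that the terms of
  \<open>xi_mult\<close> with \<open>size p = n\<close> remain.\<close>

lemma chaos_sum_wick_malliavin_xi:
  assumes "cons_L2 T e"
  shows "chaos_sum Z (wick (tensor_inner e n) (malliavin_xi T e n \<theta>) (malliavin_xi T e n \<kappa>)) \<omega>
    = fact n * (\<Sum>p | p \<subseteq># \<theta> \<inter># \<kappa> \<and> size p = n.
        contraction_coeff \<theta> \<kappa> p * xi Z ((\<theta> - p) + (\<kappa> - p)) \<omega>)"
proof -
  define g where "g p = (\<theta> - p) + (\<kappa> - p)" for p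
  define P where "P = {p. p \<subseteq># \<theta> \<inter># \<kappa> \<and> size p = n}"
  define v where "v = wick (tensor_inner e n) (malliavin_xi T e n \<theta>) (malliavin_xi T e n \<kappa>)"
  have v: "v \<alpha> = (\<Sum>p | p \<in> P \<and> g p = \<alpha>. fact n * contraction_coeff \<theta> \<kappa> p)" for \<alpha>
    by (simp add: v_def wick_malliavin_xi[OF assms] P_def g_def)
  have finP: "finite P"
    unfolding P_def by (rule finite_subset[OF _ finite_submset]) auto
  have "chaos_sum Z v \<omega> = (\<Sum>\<alpha>\<in>g ` P. v \<alpha> * xi Z \<alpha> \<omega>)"
    unfolding chaos_sum_def
  proof (rule sum.mono_neutral_left)
    show "{\<alpha>. v \<alpha> \<noteq> 0} \<subseteq> g ` P"
    proof
      fix \<alpha> assume "\<alpha> \<in> {\<alpha>. v \<alpha> \<noteq> 0}"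
      then have "{p. p \<in> P \<and> g p = \<alpha>} \<noteq> {}"
        by (auto simp only: v sum.empty mem_Collect_eq)
      then show "\<alpha> \<in> g ` P" by auto
    qed
  qed (use finP in auto)
  also have "\<dots> = (\<Sum>\<alpha>\<in>g ` P. \<Sum>p | p \<in> P \<and> g p = \<alpha>. fact n * contraction_coeff \<theta> \<kappa> p * xi Z (g p) \<omega>)"
    by (rule sum.cong) (simp_all add: v sum_distrib_right)
  also have "\<dots> = (\<Sum>p\<in>P. fact n * contraction_coeff \<theta> \<kappa> p * xi Z (g p) \<omega>)"
    by (rule sum.group) (use finP in auto)
  finally show ?thesis
    by (simp add: v_def P_def g_def sum_distrib_left mult.assoc)
qed

section \<open>The product formula\<close>

theorem proposition4:
  fixes T :: real
    and M :: "'a measure"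
    and W :: "real \<Rightarrow> 'y::{real_inner, complete_space, second_countable_topology} \<Rightarrow> 'a \<Rightarrow> real"
    and m :: "nat \<Rightarrow> real \<Rightarrow> real"
    and I :: "nat set"
    and l :: "nat \<Rightarrow> 'y"
    and k1 k2 :: "nat \<Rightarrow> nat"
    and e :: "nat \<Rightarrow> real \<Rightarrow> 'y"
    and Z :: "nat \<Rightarrow> 'a \<Rightarrow> real"
    and \<theta> \<kappa> :: multiindex
  assumes "T > 0"
    and "prob_space M"
    and "cylindrical_wiener M T W"
    and "cons_L2 T m"
    and "\<And>i. bdd_above ((\<lambda>s. \<bar>m i s\<bar>) ` {0..T})"
    and "cons_on I l"
    and "cons_L2 T e"
    and "\<And>k. k2 k \<in> I"
    and "\<And>k s. s \<in> {0..T} \<Longrightarrow> e k s = m (k1 k) s *\<^sub>R l (k2 k)"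
    and "\<And>k. has_wiener_integral M T W (e k) (Z k)"
  shows "AE \<omega> in M.
    (\<lambda>n. chaos_sum Z (wick (tensor_inner e n) (malliavin_xi T e n \<theta>) (malliavin_xi T e n \<kappa>)) \<omega> / fact n)
      sums (xi Z \<theta> \<omega> * xi Z \<kappa> \<omega>)"
proof (rule AE_I2)
  fix \<omega>
  let ?c = "\<lambda>p. contraction_coeff \<theta> \<kappa> p * xi Z ((\<theta> - p) + (\<kappa> - p)) \<omega>"
  let ?S = "\<lambda>n. {p. p \<subseteq># \<theta> \<inter># \<kappa> \<and> size p = n}"
  (* bounds the order of the nonzero terms of the series *)
  have size: "size p \<le> size \<theta>" if "p \<subseteq># \<theta> \<inter># \<kappa>" for p
    using that by (simp add: size_mset_mono)
  have coeff: "chaos_sum Z (wick (tensor_inner e n) (malliavin_xi T e n \<theta>) (malliavin_xi T e n \<kappa>)) \<omega> / fact n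
      = (\<Sum>p\<in>?S n. ?c p)" for n
    by (simp add: chaos_sum_wick_malliavin_xi[OF \<open>cons_L2 T e\<close>])
  have "(\<lambda>n. \<Sum>p\<in>?S n. ?c p) sums (\<Sum>n\<le>size \<theta>. \<Sum>p\<in>?S n. ?c p)"
  proof (rule sums_finite)
    fix n assume "n \<notin> {..size \<theta>}"
    then have "?S n = {}"
      using size by force
    then show "(\<Sum>p\<in>?S n. ?c p) = 0"
      by (simp only: sum.empty)
  qed simp
  also have "(\<Sum>n\<le>size \<theta>. \<Sum>p\<in>?S n. ?c p) = (\<Sum>p | p \<subseteq># \<theta> \<inter># \<kappa>. ?c p)"
    using sum.group[of "{p. p \<subseteq># \<theta> \<inter># \<kappa>}" "{..size \<theta>}" size ?c] size finite_submset by auto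
  finally show "(\<lambda>n. chaos_sum Z (wick (tensor_inner e n) (malliavin_xi T e n \<theta>) (malliavin_xi T e n \<kappa>)) \<omega> / fact n)
      sums (xi Z \<theta> \<omega> * xi Z \<kappa> \<omega>)"
    by (simp only: coeff xi_mult)
qed

end
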